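(* Let $r\ge 2$ and $m\ge 0$ be integers and let $\mathcal T_m^r$ be an $r$-uniform hypertree with $m$ edges. Then for every positive integer $k$, $$P_{DP}(\mathcal T_m^r,k)=P(\mathcal T_m^r,k).$$
   Context: A hypergraph $\mathcal H=(X,E)$ consists of a finite non-empty set $X$ (vertices) and a set $E\subseteq 2^X$ (edges) with $|e|\ge 2$ for every $e\in E$. It is $r$-uniform if $|e|=r$ for every $e\in E$, and linear if $|e_1\cap e_2|\le 1$ for any two distinct edges. A path is a sequence of edges $e_1,\dots,e_t$ with $e_i\cap e_{i+1}\ne\emptyset$ for $1\le i\le t-1$; $\mathcal H$ is connected if any two distinct vertices lie in (edges of) a common path (so a single vertex with no edges is connected). A cycle of length $l\ge 3$ is a subhypergraph consisting of $l$ distinct edges $e_1,\dots,e_l$ for which there are distinct vertices $v_1,\dots,v_l$ with $v_i\in e_i\cap e_{i+1}$ for $1\le i\le l-1$ and $v_l\in e_l\cap e_1$. A hypertree is a connected linear hypergraph without cycles. For a positive integer $k$ write $[k]=\{1,\dots,k\}$. A proper $k$-coloring of $\mathcal H$ is a map $f:X\to[k]$ that is not constant on any edge; $P(\mathcal H,k)$ is the number of proper $k$-colorings. A partial map $\varphi:X\rightharpoonup [k]$ is a function from a subset $\mathrm{dom}(\varphi)\subseteq X$ to $[k]$; it is identified with its graph $\{(x,\varphi(x)):x\in\mathrm{dom}(\varphi)\}\subseteq X\times[k]$. A $k$-fold cover of $\mathcal H$ is a set $\mathcal F$ of partial maps $X\rightharpoonup[k]$ such that $\mathrm{dom}(\varphi)\in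 E$ for every $\varphi\in\mathcal F$, and whenever $\varphi\neq\psi$ in $\mathcal F$ have $\mathrm{dom}(\varphi)=\mathrm{dom}(\psi)$, then $\varphi\cap\psi=\emptyset$ (i.e. $\varphi(x)\ne\psi(x)$ for all $x$ in the common domain). An $\mathcal F$-coloring of $\mathcal H$ is a function $f:X\to[k]$ such that $\varphi\not\subseteq f$ for every $\varphi\in\mathcal F$. $P_{DP}(\mathcal H,\mathcal F)$ denotes the number of $\mathcal F$-colorings, and the DP color function $P_{DP}(\mathcal H,k)$ is the minimum of $P_{DP}(\mathcal H,\mathcal F)$ over all $k$-fold covers $\mathcal F$ of $\mathcal H$. *)

theory Defs
  imports Main "HOL-Library.FuncSet"
begin

locale hypergraph =
  fixes X :: "'a set" and E :: "'a set set"
  assumes finite_vertices: "finite X"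
    and vertices_nonempty: "X \<noteq> {}"
    and edges_subset: "E \<subseteq> Pow X"
    and edge_card: "e \<in> E \<Longrightarrow> 2 \<le> card e"

definition uniform :: "nat \<Rightarrow> 'a set set \<Rightarrow> bool" where
  "uniform r E \<longleftrightarrow> (\<forall>e\<in>E. card e = r)"

definition linear_edges :: "'a set set \<Rightarrow> bool" where
  "linear_edges E \<longleftrightarrow> (\<forall>e1\<in>E. \<forall>e2\<in>E. e1 \<noteq> e2 \<longrightarrow> card (e1 \<inter> e2) \<le> 1)"

definition edge_path :: "'a set set \<Rightarrow> 'a set list \<Rightarrow> bool" where
  "edge_path E es \<longleftrightarrow> es \<noteq> [] \<and> set es \<subseteq> E \<and> successively (\<lambda>e e'. e \<inter> e' \<noteq> {}) es"

definition hconnected :: "'a set \<Rightarrow> 'a set set \<Rightarrow> bool" where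
  "hconnected X E \<longleftrightarrow>
     (\<forall>x\<in>X. \<forall>y\<in>X. x \<noteq> y \<longrightarrow>
        (\<exists>es. edge_path E es \<and> x \<in> \<Union>(set es) \<and> y \<in> \<Union>(set es)))"

definition hcycle :: "'a set set \<Rightarrow> 'a set list \<Rightarrow> bool" where
  "hcycle E es \<longleftrightarrow>
     3 \<le> length es \<and> distinct es \<and> set es \<subseteq> E \<and>
     (\<exists>vs. length vs = length es \<and> distinct vs \<and>
        (\<forall>i<length es. vs ! i \<in> es ! i \<inter> es ! (Suc i mod length es)))"

locale hypertree = hypergraph X E for X :: "'a set" and E :: "'a set set" +
  assumes connected: "hconnected X E"
    and linear: "linear_edges E"
    and acyclic: "\<nexists>es. hcycle E es"

text \<open>
  Total maps from \<open>X\<close> to the colors \<open>{1..k}\<close> are taken in the extensional function space,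
  so that each such map is counted exactly once.
\<close>

definition proper_colorings :: "'a set \<Rightarrow> 'a set set \<Rightarrow> nat \<Rightarrow> ('a \<Rightarrow> nat) set" where
  "proper_colorings X E k =
     {f \<in> X \<rightarrow>\<^sub>E {1..k}. \<forall>e\<in>E. \<not> (\<exists>c. \<forall>x\<in>e. f x = c)}"

definition chrom_fun :: "'a set \<Rightarrow> 'a set set \<Rightarrow> nat \<Rightarrow> nat" where
  "chrom_fun X E k = card (proper_colorings X E k)"

definition fold_cover :: "'a set \<Rightarrow> 'a set set \<Rightarrow> nat \<Rightarrow> ('a \<rightharpoonup> nat) set \<Rightarrow> bool" where
  "fold_cover X E k F \<longleftrightarrow>
     (\<forall>\<phi>\<in>F. dom \<phi> \<subseteq> X \<and> ran \<phi> \<subseteq> {1..k} \<and> dom \<phi> \<in> E) \<and>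
     (\<forall>\<phi>\<in>F. \<forall>\<psi>\<in>F. \<phi> \<noteq> \<psi> \<and> dom \<phi> = dom \<psi> \<longrightarrow> Map.graph \<phi> \<inter> Map.graph \<psi> = {})"

definition cover_colorings :: "'a set \<Rightarrow> nat \<Rightarrow> ('a \<rightharpoonup> nat) set \<Rightarrow> ('a \<Rightarrow> nat) set" where
  "cover_colorings X k F =
     {f \<in> X \<rightarrow>\<^sub>E {1..k}. \<forall>\<phi>\<in>F. \<not> Map.graph \<phi> \<subseteq> (\<lambda>x. (x, f x)) ` X}"

definition DP_fun_cover :: "'a set \<Rightarrow> nat \<Rightarrow> ('a \<rightharpoonup> nat) set \<Rightarrow> nat" where
  "DP_fun_cover X k F = card (cover_colorings X k F)"

definition DP_color_fun :: "'a set \<Rightarrow> 'a set set \<Rightarrow> nat \<Rightarrow> nat" where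
  "DP_color_fun X E k = Min (DP_fun_cover X k ` {F. fold_cover X E k F})"

text \<open>The minimum is taken over a finite non-empty set of numbers, hence is attained.\<close>

lemma finite_DP_fun_cover:
  assumes "finite X"
  shows "finite (DP_fun_cover X k ` {F. fold_cover X E k F})"
proof (rule finite_subset)
  have "finite (X \<rightarrow>\<^sub>E {1..k})"
    using assms by (simp add: finite_PiE)
  then show "DP_fun_cover X k ` {F. fold_cover X E k F} \<subseteq> {..card (X \<rightarrow>\<^sub>E {1..k})}"
    by (auto simp: DP_fun_cover_def cover_colorings_def intro!: card_mono)
qed simp

lemma fold_cover_empty: "fold_cover X E k {}"
  by (simp add: fold_cover_def)

end

(* A hypertree grows from a single vertex by gluing on edges, each meeting the part built so far
   in exactly one vertex: a second common vertex would close a cycle.  A coloring of the part built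
   so far has k^(|e|-1) extensions to a new edge e, and the cover forbids at most one of them,
   since two members of the cover with domain e disagree at the attaching vertex.  So every cover
   has at least k * (product over all e of k^(|e|-1) - 1) colorings, and the cover by constant maps,
   whose colorings are the proper ones, forbids exactly one extension each time. *)
theory Submission
  imports Defs
begin

section \<open>Grown hypergraphs and the Berge paths inside them\<close>

inductive tree_growth :: "'a set \<Rightarrow> 'a set set \<Rightarrow> bool" where
  vertex: "tree_growth {x} {}"
| edge: "tree_growth Y G \<Longrightarrow> e \<inter> Y = {v} \<Longrightarrow> finite e \<Longrightarrow> \<not> e \<subseteq> Y \<Longrightarrow> tree_growth (Y \<union> e) (insert e G)"

lemma tree_growth_finite: "tree_growth Y G \<Longrightarrow> finite Y \<and> finite G"
  by (induction rule: tree_growth.induct) auto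

lemma tree_growth_nonempty: "tree_growth Y G \<Longrightarrow> Y \<noteq> {}"
  by (induction rule: tree_growth.induct) auto

lemma tree_growth_edge_subset: "tree_growth Y G \<Longrightarrow> e \<in> G \<Longrightarrow> e \<subseteq> Y"
  by (induction rule: tree_growth.induct) auto

text \<open>The alternating sequence \<open>vs!0, es!0, vs!1, es!1, ...\<close> with all vertices
  and all edges distinct. Cycles ask for distinct edges and distinct connecting vertices, neither of
  which \<open>edge_path\<close> guarantees.\<close>

definition berge_path :: "'a set set \<Rightarrow> 'a \<Rightarrow> 'a set list \<Rightarrow> 'a list \<Rightarrow> 'a \<Rightarrow> bool" where
  "berge_path G u es vs v \<longleftrightarrow>
     length vs = Suc (length es) \<and> distinct es \<and> distinct vs \<and> set es \<subseteq> G \<and>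
     hd vs = u \<and> last vs = v \<and> (\<forall>i<length es. vs ! i \<in> es ! i \<and> vs ! Suc i \<in> es ! i)"

lemma berge_path_rev:
  assumes "berge_path G u es vs v"
  shows "berge_path G v (rev es) (rev vs) u"
proof -
  have "rev vs ! i \<in> rev es ! i \<and> rev vs ! Suc i \<in> rev es ! i" if "i < length es" for i
  proof -
    define j where "j = length es - Suc i"
    have j: "j < length es" "length es - i = Suc j" using that by (auto simp: j_def)
    have "length vs = Suc (length es)" using assms by (simp add: berge_path_def)
    then have "rev vs ! i = vs ! Suc j" "rev vs ! Suc i = vs ! j" "rev es ! i = es ! j"
      using that j by (simp_all add: rev_nth j_def)
    then show ?thesis using assms j by (simp add: berge_path_def)
  qed
  moreover have "vs \<noteq> []" using assms by (auto simp: berge_path_def)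
  ultimately show ?thesis
    using assms by (simp add: berge_path_def hd_rev last_rev)
qed

lemma berge_path_Cons:
  assumes "berge_path G w es vs v" and "u \<in> e" "w \<in> e" "e \<notin> G" "u \<notin> set vs"
  shows "berge_path (insert e G) u (e # es) (u # vs) v"
proof -
  have "vs \<noteq> []" using assms(1) by (auto simp: berge_path_def)
  then show ?thesis
    using assms by (auto simp: berge_path_def nth_Cons' hd_conv_nth less_Suc_eq_0_disj)
qed

text \<open>Induction on the growth: a path that leaves \<open>Y\<close> can only pass through the
  attaching vertex \<open>w\<close>, so a vertex \<open>a\<close> of \<open>e\<close> outside
  \<open>Y\<close> is joined to \<open>b\<close> by prefixing \<open>e\<close> to an old path from
  \<open>w\<close> to \<open>b\<close>. The bound \<open>set vs \<subseteq> Y\<close> is carried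
  along because it makes the new end \<open>a\<close> distinct from the old path vertices.\<close>

lemma tree_growth_berge_path:
  assumes "tree_growth Y G" and "u \<in> Y" "v \<in> Y" "u \<noteq> v"
  shows "\<exists>es vs. berge_path G u es vs v \<and> set vs \<subseteq> Y"
  using assms
proof (induction arbitrary: u v rule: tree_growth.induct)
  case (edge Y G e w)
  \<comment> \<open>Edges of \<open>G\<close> lie in \<open>Y\<close>, whereas \<open>e\<close> has
    a vertex outside \<open>Y\<close>.\<close>
  have e: "e \<notin> G" using edge.hyps tree_growth_edge_subset by blast
  have w: "w \<in> e" "w \<in> Y" using edge.hyps by auto
  have to_new: "\<exists>es vs. berge_path (insert e G) a es vs b \<and> set vs \<subseteq> Y \<union> e"
    if "a \<in> e - Y" "b \<in> Y" for a b
  proof (cases "b = w")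
    case True
    with that w show ?thesis
      by (intro exI[of _ "[e]"] exI[of _ "[a, b]"]) (auto simp: berge_path_def)
  next
    case False
    then have "\<exists>es vs. berge_path G w es vs b \<and> set vs \<subseteq> Y"
      using edge.IH[of w b] w that by auto
    then obtain es vs where p: "berge_path G w es vs b" "set vs \<subseteq> Y" by blast
    then have "berge_path (insert e G) a (e # es) (a # vs) b"
      using berge_path_Cons[OF p(1)] w that e by blast
    with p that show ?thesis by (intro exI conjI) auto
  qed
  consider "u \<in> Y" "v \<in> Y" | "u \<in> e" "v \<in> e" | "u \<in> e - Y" "v \<in> Y" | "v \<in> e - Y" "u \<in> Y"
    using edge.prems by blast
  then show ?case
  proof cases
    case 1
    then obtain es vs where "berge_path G u es vs v" "set vs \<subseteq> Y"
      using edge.IH edge.prems by blast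
    then show ?thesis
      by (intro exI[of _ es] exI[of _ vs]) (auto simp: berge_path_def)
  next
    case 2
    with edge.prems show ?thesis
      by (intro exI[of _ "[e]"] exI[of _ "[u, v]"]) (auto simp: berge_path_def)
  next
    case 3
    then show ?thesis using to_new by blast
  next
    case 4
    then show ?thesis using to_new berge_path_rev by (metis set_rev)
  qed
qed auto

text \<open>With \<open>e\<close> put in front, \<open>vs!i\<close> lies in the edges at positions
  \<open>i\<close> and \<open>i + 1\<close> of \<open>e # es\<close>; the last vertex
  \<open>v\<close> lies in the last edge and, after wrapping around, in \<open>e\<close> again. Two
  path edges are what brings the cycle to length at least 3.\<close>

lemma berge_path_closing_edge:
  assumes p: "berge_path G u es vs v" and e: "e \<notin> G" "u \<in> e" "v \<in> e"
    and len: "2 \<le> length es"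
  shows "hcycle (insert e G) (e # es)"
proof -
  have l: "length vs = Suc (length es)" using p by (simp add: berge_path_def)
  then have ne: "vs \<noteq> []" by auto
  have 0: "vs ! 0 = u" using p ne by (simp add: berge_path_def hd_conv_nth)
  have last: "vs ! length es = v" using p ne l by (simp add: berge_path_def last_conv_nth)
  have "vs ! i \<in> (e # es) ! i \<inter> (e # es) ! (Suc i mod length (e # es))"
    if "i < length (e # es)" for i
  proof (cases "i = length es")
    case True
    obtain j where "length es = Suc j" using len by (cases es) auto
    with True have j: "i = Suc j" "j < length es" by auto
    then have "vs ! Suc j \<in> es ! j" using p by (simp add: berge_path_def)
    moreover have "(e # es) ! i = es ! j" using j by simp
    moreover have "vs ! i = v" "Suc i mod length (e # es) = 0" using True last by simp_all
    ultimately show ?thesis using e j by simp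
  next
    case False
    then have i: "i < length es" using that by simp
    then have "vs ! i \<in> es ! i" using p by (simp add: berge_path_def)
    moreover have "vs ! i \<in> (e # es) ! i"
      using p 0 e i by (cases i) (auto simp: berge_path_def)
    ultimately show ?thesis using i by simp
  qed
  then show ?thesis
    using p e len l unfolding hcycle_def by (auto simp: berge_path_def)
qed

section \<open>Every hypertree is grown from a vertex\<close>

lemma hcycle_mono: "hcycle G es \<Longrightarrow> G \<subseteq> E \<Longrightarrow> hcycle E es"
  unfolding hcycle_def by blast

text \<open>Edges of \<open>G\<close> lie inside \<open>Y\<close> and the others miss
  \<open>Y\<close>, so consecutive edges of a path are both in \<open>G\<close> or both outside it.
  The edge through \<open>y\<close> meets \<open>Y\<close>, so the whole path stays in
  \<open>G\<close>, hence in \<open>Y\<close>.\<close>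

lemma edge_path_within:
  assumes path: "edge_path E es" "x \<in> \<Union>(set es)" "y \<in> \<Union>(set es)"
    and y: "y \<in> Y" and G: "\<And>e. e \<in> G \<Longrightarrow> e \<subseteq> Y" and E: "\<And>e. e \<in> E - G \<Longrightarrow> e \<inter> Y = {}"
  shows "x \<in> Y"
proof -
  have iff: "e \<in> G \<longleftrightarrow> e' \<in> G" if "e \<in> E" "e' \<in> E" "e \<inter> e' \<noteq> {}" for e e'
    using that G E by (cases "e \<in> G"; cases "e' \<in> G") blast+
  have all: "(\<forall>e\<in>set es. e \<in> G) \<or> (\<forall>e\<in>set es. e \<notin> G)"
    if "successively (\<lambda>e e'. e \<inter> e' \<noteq> {}) es" "set es \<subseteq> E" for es
    using that by (induction es rule: induct_list012) (auto dest: iff)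
  from path y G E all[of es] show ?thesis
    unfolding edge_path_def by blast
qed

context hypertree
begin

text \<open>Two common vertices are joined by a Berge path in \<open>G\<close>. A path of two or
  more edges closes to a cycle with \<open>e\<close>; a path of one edge gives an edge sharing two
  vertices with \<open>e\<close>, against linearity.\<close>

lemma edge_meets_growth_once:
  assumes growth: "tree_growth Y G" "G \<subseteq> E" and e: "e \<in> E - G" and uv: "u \<in> e \<inter> Y" "v \<in> e \<inter> Y"
  shows "u = v"
proof (rule ccontr)
  assume "u \<noteq> v"
  then obtain es vs where p: "berge_path G u es vs v"
    using tree_growth_berge_path[OF growth(1)] uv by blast
  show False
  proof (cases "2 \<le> length es")
    case True
    then have "hcycle (insert e G) (e # es)"
      using berge_path_closing_edge[OF p] e uv by blast
    then show False using hcycle_mono[of _ _ E] acyclic e growth(2) by blast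
  next
    case False
    moreover have "es \<noteq> []"
      using p \<open>u \<noteq> v\<close> by (cases vs) (auto simp: berge_path_def)
    ultimately obtain e' where es: "es = [e']"
      by (cases es; cases "tl es") auto
    then obtain a b where "vs = [a, b]"
      using p by (auto simp: berge_path_def length_Suc_conv)
    with p es have e': "e' \<in> G" "u \<in> e'" "v \<in> e'" by (auto simp: berge_path_def)
    then have "e' \<in> E" "e' \<noteq> e" using growth e by auto
    then have "card (e \<inter> e') \<le> 1"
      using linear e unfolding linear_edges_def by blast
    moreover have "finite (e \<inter> e')"
      using e edges_subset finite_vertices finite_subset by blast
    ultimately show False
      using e' uv \<open>u \<noteq> v\<close> by (metis IntD1 IntI One_nat_def card_le_Suc0_iff_eq)
  qed
qed

text \<open>Among the grown subhypergraphs one with the most vertices is taken. An edge outside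
  \<open>G\<close> that meets \<open>Y\<close> could be glued on and would enlarge it, so all such
  edges miss \<open>Y\<close>; connectedness then leaves no vertex outside \<open>Y\<close>.\<close>

lemma tree_growth_hypertree: "tree_growth X E"
proof -
  let ?P = "\<lambda>(Y, G). tree_growth Y G \<and> Y \<subseteq> X \<and> G \<subseteq> E"
  obtain x where "x \<in> X" using vertices_nonempty by blast
  then have "?P ({x}, {})" by (simp add: tree_growth.vertex)
  moreover have "\<forall>p. ?P p \<longrightarrow> card (fst p) < Suc (card X)"
    using finite_vertices by (auto intro: card_mono simp: less_Suc_eq_le)
  ultimately have "\<exists>p. ?P p \<and> (\<forall>q. ?P q \<longrightarrow> card (fst q) \<le> card (fst p))"
    by (rule ex_has_greatest_nat)
  then obtain p where p: "?P p" "\<forall>q. ?P q \<longrightarrow> card (fst q) \<le> card (fst p)" by blast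
  obtain Y G where "p = (Y, G)" by (cases p)
  with p have growth: "tree_growth Y G" and sub: "Y \<subseteq> X" "G \<subseteq> E"
    and max: "\<And>Y' G'. tree_growth Y' G' \<Longrightarrow> Y' \<subseteq> X \<Longrightarrow> G' \<subseteq> E \<Longrightarrow> card Y' \<le> card Y"
    by auto
  have large: "finite e" "2 \<le> card e" "e \<subseteq> X" if "e \<in> E" for e
    using that edges_subset finite_vertices edge_card by (auto intro: finite_subset)
  have disjoint: "e \<inter> Y = {}" if e: "e \<in> E - G" for e
  proof (rule ccontr)
    assume "e \<inter> Y \<noteq> {}"
    then obtain v where v: "e \<inter> Y = {v}"
      using edge_meets_growth_once[OF growth sub(2) e] by blast
    \<comment> \<open>Otherwise \<open>e\<close> would be the single vertex \<open>v\<close>, but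
      edges have at least two vertices.\<close>
    have new: "\<not> e \<subseteq> Y"
    proof
      assume "e \<subseteq> Y"
      then have "e = {v}" using v by blast
      then show False using large(2)[of e] e by simp
    qed
    then have "tree_growth (Y \<union> e) (insert e G)"
      using tree_growth.edge[OF growth v] large e by blast
    then have "card (Y \<union> e) \<le> card Y"
      using max e large(3)[of e] sub by blast
    moreover have "card Y < card (Y \<union> e)"
      using new tree_growth_finite[OF growth] large(1)[of e] e
      by (intro psubset_card_mono) auto
    ultimately show False by simp
  qed
  have "Y = X"
  proof (intro equalityI subsetI)
    fix x assume x: "x \<in> X"
    obtain y where y: "y \<in> Y" using tree_growth_nonempty[OF growth] by blast
    show "x \<in> Y"
    proof (cases "x = y")
      case False
      moreover have "y \<in> X" using y sub by blast
      ultimately obtain es where "edge_path E es" "x \<in> \<Union>(set es)" "y \<in> \<Union>(set es)"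
        using connected x unfolding hconnected_def by blast
      then show ?thesis
        using y tree_growth_edge_subset[OF growth] disjoint by (rule edge_path_within)
    qed (use y in simp)
  qed (use sub in blast)
  \<comment> \<open>Edges are nonempty, so once \<open>Y\<close> is all of \<open>X\<close> no edge
    can miss it.\<close>
  moreover have "E \<subseteq> G"
  proof
    fix e assume e: "e \<in> E"
    then have "e \<inter> Y \<noteq> {}" using large(2,3)[of e] \<open>Y = X\<close> by (auto simp: Int_absorb2)
    with e disjoint show "e \<in> G" by blast
  qed
  ultimately show ?thesis using growth sub by auto
qed

end

section \<open>Counting the colorings of a cover\<close>

lemma cover_colorings_eq:
  assumes "fold_cover X E k F"
  shows "cover_colorings X k F =
    {f \<in> X \<rightarrow>\<^sub>E {1..k}. \<forall>\<phi>\<in>F. \<exists>x\<in>dom \<phi>. \<phi> x \<noteq> Some (f x)}"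
proof -
  have "Map.graph \<phi> \<subseteq> (\<lambda>x. (x, f x)) ` X \<longleftrightarrow> (\<forall>x\<in>dom \<phi>. \<phi> x = Some (f x))"
    if "\<phi> \<in> F" for \<phi> and f :: "'a \<Rightarrow> nat"
  proof -
    \<comment> \<open>This is why cutting the graph of \<open>f\<close> down to \<open>X\<close>
      loses nothing.\<close>
    have "dom \<phi> \<subseteq> X" using that assms unfolding fold_cover_def by blast
    then show ?thesis by (auto simp: Map.graph_def dom_def subset_iff image_iff)
  qed
  then show ?thesis
    unfolding cover_colorings_def by (intro Collect_cong conj_cong ball_cong refl) simp
qed

lemma fold_cover_restrict:
  assumes "fold_cover X E k F" and "\<And>e. e \<in> G \<Longrightarrow> e \<subseteq> Y"
  shows "fold_cover Y G k {\<phi> \<in> F. dom \<phi> \<in> G}"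
  using assms by (simp add: fold_cover_def)

text \<open>A coloring of the old part influences which extensions to \<open>e\<close> are forbidden
  only through its color \<open>c\<close> at the attaching vertex \<open>v\<close>. Hence
  \<open>c\<close>, and not the whole coloring, is the parameter.\<close>

definition forbidden_extensions ::
  "'a set \<Rightarrow> 'a \<Rightarrow> nat \<Rightarrow> ('a \<rightharpoonup> nat) set \<Rightarrow> nat \<Rightarrow> ('a \<Rightarrow> nat) set" where
  "forbidden_extensions e v k F c =
     {g \<in> (e - {v}) \<rightarrow>\<^sub>E {1..k}. \<exists>\<phi>\<in>F. dom \<phi> = e \<and> \<phi> v = Some c \<and> (\<forall>x\<in>e - {v}. \<phi> x = Some (g x))}"

lemma fold_cover_eqI:
  assumes "fold_cover X E k F" "\<phi> \<in> F" "\<psi> \<in> F" "dom \<phi> = dom \<psi>" "\<phi> v = Some c" "\<psi> v = Some c"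
  shows "\<phi> = \<psi>"
proof (rule ccontr)
  assume "\<phi> \<noteq> \<psi>"
  then have "Map.graph \<phi> \<inter> Map.graph \<psi> = {}"
    using assms unfolding fold_cover_def by blast
  moreover have "(v, c) \<in> Map.graph \<phi> \<inter> Map.graph \<psi>"
    using assms by (simp add: Map.graph_def)
  ultimately show False by blast
qed

text \<open>Members of the cover behind two forbidden extensions both send \<open>v\<close> to
  \<open>c\<close>, so they coincide, and that one map fixes the extension on
  \<open>e - {v}\<close>.\<close>

lemma card_forbidden_extensions_le:
  assumes "fold_cover X E k F" "finite e"
  shows "card (forbidden_extensions e v k F c) \<le> 1"
proof -
  have "g = h" if "g \<in> forbidden_extensions e v k F c" "h \<in> forbidden_extensions e v k F c" for g h
  proof -
    from that obtain \<phi> \<psi> where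
      \<phi>: "\<phi> \<in> F" "dom \<phi> = e" "\<phi> v = Some c" "\<forall>x\<in>e - {v}. \<phi> x = Some (g x)" and
      \<psi>: "\<psi> \<in> F" "dom \<psi> = e" "\<psi> v = Some c" "\<forall>x\<in>e - {v}. \<psi> x = Some (h x)"
      unfolding forbidden_extensions_def by blast
    have "\<phi> = \<psi>" using fold_cover_eqI[OF assms(1)] \<phi> \<psi> by metis
    then have "\<forall>x\<in>e - {v}. g x = h x" using \<phi> \<psi> by auto
    with that show "g = h"
      unfolding forbidden_extensions_def by (auto intro: PiE_ext)
  qed
  moreover have "finite (forbidden_extensions e v k F c)"
    using assms(2) by (simp add: forbidden_extensions_def finite_PiE)
  ultimately show ?thesis by (auto simp: card_le_Suc0_iff_eq)
qed

text \<open>The equality case: for such a cover the bound of at most one forbidden extension becomes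
  exactly one.\<close>

definition full_cover :: "'a set set \<Rightarrow> nat \<Rightarrow> ('a \<rightharpoonup> nat) set \<Rightarrow> bool" where
  "full_cover E k F \<longleftrightarrow> (\<forall>e\<in>E. \<forall>v\<in>e. \<forall>c\<in>{1..k}. \<exists>\<phi>\<in>F. dom \<phi> = e \<and> \<phi> v = Some c)"

lemma card_forbidden_extensions_eq:
  assumes F: "fold_cover X E k F" "full_cover E k F" and e: "finite e" "e \<in> E" "v \<in> e"
    and c: "c \<in> {1..k}"
  shows "card (forbidden_extensions e v k F c) = 1"
proof -
  obtain \<phi> where \<phi>: "\<phi> \<in> F" "dom \<phi> = e" "\<phi> v = Some c"
    using F e c unfolding full_cover_def by blast
  have "ran \<phi> \<subseteq> {1..k}" using F \<phi> unfolding fold_cover_def by blast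
  \<comment> \<open>The witness is the cover member itself, read as an extensional function on
    \<open>e - {v}\<close>. Since its domain is \<open>e\<close>, the operator \<open>the\<close> is
    only applied to defined values there.\<close>
  then have "restrict (\<lambda>x. the (\<phi> x)) (e - {v}) \<in> forbidden_extensions e v k F c"
    using \<phi> unfolding forbidden_extensions_def
    by (auto intro!: bexI[of _ \<phi>] simp: ran_def)
  moreover have "finite (forbidden_extensions e v k F c)"
    using e by (simp add: forbidden_extensions_def finite_PiE)
  ultimately have "1 \<le> card (forbidden_extensions e v k F c)"
    by (metis One_nat_def Suc_leI card_gt_0_iff empty_iff)
  then show ?thesis
    using card_forbidden_extensions_le[OF F(1) e(1)] by (meson le_antisym)
qed

text \<open>A coloring of \<open>Y \<union> e\<close> splits uniquely into its restriction
  \<open>f\<close> to \<open>Y\<close> and its restriction \<open>g\<close> to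
  \<open>e - {v}\<close>. Cover members with domain in \<open>G\<close> constrain only
  \<open>f\<close>; those with domain \<open>e\<close> say exactly that \<open>g\<close> is not
  forbidden for \<open>f v\<close>. Summing over \<open>f\<close> gives the count.\<close>

lemma card_cover_colorings_glue:
  assumes Y: "finite Y" and G: "\<And>e'. e' \<in> G \<Longrightarrow> e' \<subseteq> Y" and e: "e \<inter> Y = {v}" "finite e" "\<not> e \<subseteq> Y"
    and F: "fold_cover (Y \<union> e) (insert e G) k F"
  defines "F' \<equiv> {\<phi> \<in> F. dom \<phi> \<in> G}"
  shows "card (cover_colorings (Y \<union> e) k F) =
    (\<Sum>f\<in>cover_colorings Y k F'. k ^ (card e - 1) - card (forbidden_extensions e v k F (f v)))"
proof -
  have F': "fold_cover Y G k F'"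
    unfolding F'_def using F G by (rule fold_cover_restrict)
  let ?D = "e - {v}"
  let ?A = "SIGMA f:cover_colorings Y k F'. (?D \<rightarrow>\<^sub>E {1..k}) - forbidden_extensions e v k F (f v)"
  \<comment> \<open>Outside \<open>Y \<union> e\<close> the second branch returns
    \<open>undefined\<close>, because \<open>g\<close> is extensional on \<open>e - {v}\<close>; so
    the glued function is extensional as well.\<close>
  let ?glue = "\<lambda>(f, g) x. if x \<in> Y then f x else g x"
  have D: "?D \<inter> Y = {}" "?D \<union> Y = Y \<union> e" "v \<in> Y" "v \<in> e" using e by auto
  have dom: "dom \<phi> = e \<or> \<phi> \<in> F'" if "\<phi> \<in> F" for \<phi>
  proof -
    have "dom \<phi> \<in> insert e G" using F that by (simp add: fold_cover_def)
    with that show ?thesis by (auto simp: F'_def)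
  qed
  have F'_sub: "dom \<phi> \<subseteq> Y" "\<phi> \<in> F" "dom \<phi> \<noteq> e" if "\<phi> \<in> F'" for \<phi>
    using that G e by (auto simp: F'_def)
  have good: "?glue (f, g) \<in> cover_colorings (Y \<union> e) k F \<longleftrightarrow> (f, g) \<in> ?A"
    if f: "f \<in> Y \<rightarrow>\<^sub>E {1..k}" and g: "g \<in> ?D \<rightarrow>\<^sub>E {1..k}" for f g
  proof -
    let ?h = "?glue (f, g)"
    have h: "?h \<in> (Y \<union> e) \<rightarrow>\<^sub>E {1..k}"
      using f g D by (auto simp: PiE_iff extensional_def)
    \<comment> \<open>Every cover member has domain \<open>e\<close> or belongs to
      \<open>F'\<close>, which separates the two kinds of constraint.\<close>
    have split: "(\<forall>\<phi>\<in>F. P \<phi>) \<longleftrightarrow> (\<forall>\<phi>\<in>F'. P \<phi>) \<and> (\<forall>\<phi>\<in>F. dom \<phi> = e \<longrightarrow> P \<phi>)" for P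
      using dom F'_sub(2) by blast
    have "?h \<in> cover_colorings (Y \<union> e) k F \<longleftrightarrow> (\<forall>\<phi>\<in>F. \<exists>x\<in>dom \<phi>. \<phi> x \<noteq> Some (?h x))"
      using h unfolding cover_colorings_eq[OF F] by blast
    also have "\<dots> \<longleftrightarrow>
        (\<forall>\<phi>\<in>F'. \<exists>x\<in>dom \<phi>. \<phi> x \<noteq> Some (?h x)) \<and>
        (\<forall>\<phi>\<in>F. dom \<phi> = e \<longrightarrow> (\<exists>x\<in>e. \<phi> x \<noteq> Some (?h x)))"
      unfolding split[of "\<lambda>\<phi>. \<exists>x\<in>dom \<phi>. \<phi> x \<noteq> Some (?h x)"] by simp
    also have "(\<forall>\<phi>\<in>F'. \<exists>x\<in>dom \<phi>. \<phi> x \<noteq> Some (?h x)) \<longleftrightarrow> f \<in> cover_colorings Y k F'"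
    proof -
      have "(\<exists>x\<in>dom \<phi>. \<phi> x \<noteq> Some (?h x)) \<longleftrightarrow> (\<exists>x\<in>dom \<phi>. \<phi> x \<noteq> Some (f x))" if "\<phi> \<in> F'" for \<phi>
        by (rule bex_cong[OF refl]) (use F'_sub(1)[OF that] in auto)
      then show ?thesis using f by (simp add: cover_colorings_eq[OF F'])
    qed
    also have "(\<forall>\<phi>\<in>F. dom \<phi> = e \<longrightarrow> (\<exists>x\<in>e. \<phi> x \<noteq> Some (?h x))) \<longleftrightarrow>
        g \<notin> forbidden_extensions e v k F (f v)"
    proof -
      \<comment> \<open>The glued function takes its value at \<open>v\<close> from
        \<open>f\<close>, since \<open>v\<close> is in \<open>Y\<close>, and all its other values on
        \<open>e\<close> from \<open>g\<close>.\<close>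
      have eq: "(\<forall>x\<in>e. \<phi> x = Some (?h x)) \<longleftrightarrow>
          \<phi> v = Some (f v) \<and> (\<forall>x\<in>?D. \<phi> x = Some (g x))" for \<phi>
        using D by auto
      have "g \<notin> forbidden_extensions e v k F (f v) \<longleftrightarrow> (\<forall>\<phi>\<in>F. dom \<phi> = e \<longrightarrow>
          \<not> (\<phi> v = Some (f v) \<and> (\<forall>x\<in>?D. \<phi> x = Some (g x))))"
        using g unfolding forbidden_extensions_def mem_Collect_eq
        by (metis (no_types, lifting))
      then show ?thesis unfolding eq[symmetric] by simp
    qed
    finally show ?thesis using g by auto
  qed
  have "bij_betw ?glue ?A (cover_colorings (Y \<union> e) k F)"
  proof (rule bij_betw_imageI)
    show "inj_on ?glue ?A"
    proof (rule inj_onI, clarify)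
      fix f g f' g'
      assume *: "f \<in> cover_colorings Y k F'" "f' \<in> cover_colorings Y k F'"
        "g \<in> ?D \<rightarrow>\<^sub>E {1..k}" "g' \<in> ?D \<rightarrow>\<^sub>E {1..k}"
        and eq: "(\<lambda>x. if x \<in> Y then f x else g x) = (\<lambda>x. if x \<in> Y then f' x else g' x)"
      have "f x = f' x" if "x \<in> Y" for x using fun_cong[OF eq, of x] that by simp
      moreover have "g x = g' x" if "x \<in> ?D" for x
        using fun_cong[OF eq, of x] that D(1) by (auto split: if_splits)
      ultimately show "f = f' \<and> g = g'"
        using * unfolding cover_colorings_def by (auto intro: PiE_ext)
    qed
    show "?glue ` ?A = cover_colorings (Y \<union> e) k F"
    proof (intro equalityI subsetI)
      fix h assume "h \<in> ?glue ` ?A"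
      then obtain f g where p: "h = ?glue (f, g)" "(f, g) \<in> ?A" by blast
      then have "f \<in> Y \<rightarrow>\<^sub>E {1..k}" "g \<in> ?D \<rightarrow>\<^sub>E {1..k}" by (auto simp: cover_colorings_def)
      with good p show "h \<in> cover_colorings (Y \<union> e) k F" by blast
    next
      fix h assume h: "h \<in> cover_colorings (Y \<union> e) k F"
      then have hP: "h \<in> (Y \<union> e) \<rightarrow>\<^sub>E {1..k}" by (simp add: cover_colorings_def)
      let ?f = "restrict h Y" and ?g = "restrict h ?D"
      have fg: "?f \<in> Y \<rightarrow>\<^sub>E {1..k}" "?g \<in> ?D \<rightarrow>\<^sub>E {1..k}" using hP by auto
      have eq: "?glue (?f, ?g) = h"
        using hP D by (auto simp: fun_eq_iff PiE_iff extensional_def)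
      then have "(?f, ?g) \<in> ?A" using good[OF fg] h by simp
      then show "h \<in> ?glue ` ?A"
        by (rule image_eqI[where f = ?glue and x = "(?f, ?g)", OF eq[symmetric]])
    qed
  qed
  then have "card (cover_colorings (Y \<union> e) k F) = card ?A"
    by (simp add: bij_betw_same_card)
  also have "\<dots> = (\<Sum>f\<in>cover_colorings Y k F'.
      card ((?D \<rightarrow>\<^sub>E {1..k}) - forbidden_extensions e v k F (f v)))"
    using Y e by (intro card_SigmaI) (auto simp: cover_colorings_def finite_PiE)
  also have "\<dots> = (\<Sum>f\<in>cover_colorings Y k F'.
      k ^ (card e - 1) - card (forbidden_extensions e v k F (f v)))"
  proof (rule sum.cong[OF refl])
    fix f
    have "card (?D \<rightarrow>\<^sub>E {1..k}) = k ^ (card e - 1)"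
      using e D by (simp add: card_PiE card_Diff_singleton)
    \<comment> \<open>This inclusion turns the cardinality of the set difference into a difference
      of cardinalities, so the natural subtraction is not truncated.\<close>
    moreover have "forbidden_extensions e v k F (f v) \<subseteq> ?D \<rightarrow>\<^sub>E {1..k}"
      by (auto simp: forbidden_extensions_def)
    moreover have "finite (?D \<rightarrow>\<^sub>E {1..k})"
      using e by (simp add: finite_PiE)
    ultimately show "card ((?D \<rightarrow>\<^sub>E {1..k}) - forbidden_extensions e v k F (f v)) =
      k ^ (card e - 1) - card (forbidden_extensions e v k F (f v))"
      by (metis card_Diff_subset finite_subset)
  qed
  finally show ?thesis .
qed

text \<open>Bound and equality share one induction because both evaluate the same sum, whose terms
  have at most, respectively exactly, one extension removed. The cover is kept arbitrary since the
  step passes from \<open>F\<close> to its members with domain in \<open>G\<close>.\<close>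

lemma tree_growth_card_cover_colorings:
  assumes "tree_growth Y G" and "fold_cover Y G k F"
  shows "k * (\<Prod>e\<in>G. k ^ (card e - 1) - 1) \<le> card (cover_colorings Y k F) \<and>
    (full_cover G k F \<longrightarrow> card (cover_colorings Y k F) = k * (\<Prod>e\<in>G. k ^ (card e - 1) - 1))"
  using assms
proof (induction arbitrary: F rule: tree_growth.induct)
  case (vertex x)
  then have "F = {}" by (auto simp: fold_cover_def)
  then have "cover_colorings {x} k F = {x} \<rightarrow>\<^sub>E {1..k}" by (auto simp: cover_colorings_def)
  then show ?case by (simp add: card_PiE)
next
  case (edge Y G e v)
  define F' where "F' = {\<phi> \<in> F. dom \<phi> \<in> G}"
  note sub = tree_growth_edge_subset[OF edge.hyps(1)]
  have fin: "finite Y" "finite G" using tree_growth_finite[OF edge.hyps(1)] by auto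
  have e: "e \<notin> G" using sub edge.hyps by blast
  have F': "fold_cover Y G k F'"
    unfolding F'_def using edge.prems sub by (rule fold_cover_restrict)
  let ?q = "k ^ (card e - 1) - 1"
  have eq: "card (cover_colorings (Y \<union> e) k F) =
    (\<Sum>f\<in>cover_colorings Y k F'. k ^ (card e - 1) - card (forbidden_extensions e v k F (f v)))"
    unfolding F'_def
    by (rule card_cover_colorings_glue[OF fin(1) sub edge.hyps(2-4) edge.prems])
  have prod: "k * (\<Prod>e\<in>insert e G. k ^ (card e - 1) - 1) = k * (\<Prod>e\<in>G. k ^ (card e - 1) - 1) * ?q"
    using fin e by (simp add: mult_ac)
  have "k * (\<Prod>e\<in>G. k ^ (card e - 1) - 1) * ?q \<le> card (cover_colorings Y k F') * ?q"
    using edge.IH[OF F'] by (simp add: mult_le_mono1)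
  also have "\<dots> = (\<Sum>f\<in>cover_colorings Y k F'. ?q)" by simp
  also have "\<dots> \<le> card (cover_colorings (Y \<union> e) k F)"
    unfolding eq
    by (intro sum_mono diff_le_mono2 card_forbidden_extensions_le[OF edge.prems edge.hyps(3)])
  finally have le: "k * (\<Prod>e\<in>insert e G. k ^ (card e - 1) - 1) \<le> card (cover_colorings (Y \<union> e) k F)"
    unfolding prod .
  have "card (cover_colorings (Y \<union> e) k F) = k * (\<Prod>e\<in>insert e G. k ^ (card e - 1) - 1)"
    if full: "full_cover (insert e G) k F"
  proof -
    have "full_cover G k F'"
      using full unfolding full_cover_def F'_def by fastforce
    then have IH: "card (cover_colorings Y k F') = k * (\<Prod>e\<in>G. k ^ (card e - 1) - 1)"
      using edge.IH[OF F'] by blast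
    have "card (forbidden_extensions e v k F (f v)) = 1" if "f \<in> cover_colorings Y k F'" for f
    proof (rule card_forbidden_extensions_eq[OF edge.prems full edge.hyps(3)])
      show "v \<in> e" using edge.hyps by blast
      show "f v \<in> {1..k}" using that edge.hyps unfolding cover_colorings_def by blast
    qed simp
    then have "card (cover_colorings (Y \<union> e) k F) = card (cover_colorings Y k F') * ?q"
      unfolding eq by simp
    then show ?thesis unfolding prod IH .
  qed
  with le show ?case by blast
qed

section \<open>The cover by constant maps\<close>

definition constant_cover :: "'a set set \<Rightarrow> nat \<Rightarrow> ('a \<rightharpoonup> nat) set" where
  "constant_cover E k = {(\<lambda>x. if x \<in> e then Some c else None) | e c. e \<in> E \<and> c \<in> {1..k}}"

lemma fold_cover_constant_cover:
  assumes "E \<subseteq> Pow X"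
  shows "fold_cover X E k (constant_cover E k)"
  using assms unfolding fold_cover_def constant_cover_def
  by (fastforce simp: dom_def ran_def Map.graph_def split: if_splits)

lemma full_cover_constant_cover: "full_cover E k (constant_cover E k)"
  unfolding full_cover_def constant_cover_def by (fastforce simp: dom_def split: if_splits)

text \<open>Avoiding the constant maps means not being constant on an edge with a color from
  \<open>{1..k}\<close>. The constant in \<open>proper_colorings\<close> ranges over all naturals,
  but on a nonempty edge it is a value of \<open>f\<close> and so lies in that range.\<close>

lemma cover_colorings_constant_cover:
  assumes E: "E \<subseteq> Pow X" "{} \<notin> E"
  shows "cover_colorings X k (constant_cover E k) = proper_colorings X E k"
proof -
  have "(\<forall>\<phi>\<in>constant_cover E k. \<exists>x\<in>dom \<phi>. \<phi> x \<noteq> Some (f x)) \<longleftrightarrow>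
      (\<forall>e\<in>E. \<not> (\<exists>c. \<forall>x\<in>e. f x = c))" if f: "f \<in> X \<rightarrow>\<^sub>E {1..k}" for f
  proof -
    have in_range: "(\<exists>c. \<forall>x\<in>e. f x = c) \<longleftrightarrow> (\<exists>c\<in>{1..k}. \<forall>x\<in>e. f x = c)" if "e \<in> E" for e
    proof -
      obtain x where "x \<in> e" using \<open>e \<in> E\<close> E by (metis all_not_in_conv)
      then have "x \<in> X" using \<open>e \<in> E\<close> E by blast
      with f have "f x \<in> {1..k}" by (rule PiE_mem)
      then show ?thesis using \<open>x \<in> e\<close> by metis
    qed
    have "(\<forall>\<phi>\<in>constant_cover E k. \<exists>x\<in>dom \<phi>. \<phi> x \<noteq> Some (f x)) \<longleftrightarrow>
        (\<forall>e\<in>E. \<forall>c\<in>{1..k}. \<exists>x\<in>e. f x \<noteq> c)"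
    proof -
      have dom: "dom (\<lambda>x. if x \<in> e then Some c else None) = e" for e and c :: nat
        by (simp add: dom_def)
      have "(\<forall>\<phi>\<in>constant_cover E k. P \<phi>) \<longleftrightarrow>
          (\<forall>e\<in>E. \<forall>c\<in>{1..k}. P (\<lambda>x. if x \<in> e then Some c else None))" for P
        unfolding constant_cover_def by blast
      then show ?thesis by (simp add: dom eq_commute[of _ "f _"])
    qed
    also have "\<dots> \<longleftrightarrow> (\<forall>e\<in>E. \<not> (\<exists>c\<in>{1..k}. \<forall>x\<in>e. f x = c))" by simp
    also have "\<dots> \<longleftrightarrow> (\<forall>e\<in>E. \<not> (\<exists>c. \<forall>x\<in>e. f x = c))"
      by (rule ball_cong[OF refl]) (simp only: in_range)
    finally show ?thesis .
  qed
  then show ?thesis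
    unfolding cover_colorings_eq[OF fold_cover_constant_cover[OF E(1)]] proper_colorings_def
    by blast
qed

theorem lemma8:
  fixes X :: "'a set" and E :: "'a set set" and r m k :: nat
  assumes "2 \<le> r"
    and "hypertree X E"
    and "uniform r E"
    and "card E = m"
    and "0 < k"
  shows "DP_color_fun X E k = chrom_fun X E k"
proof -
  interpret hypertree X E by fact
  note count = tree_growth_card_cover_colorings[OF tree_growth_hypertree]
  note const = fold_cover_constant_cover[OF edges_subset]
  have "{} \<notin> E" using edge_card by fastforce
  then have chrom: "DP_fun_cover X k (constant_cover E k) = chrom_fun X E k"
    using cover_colorings_constant_cover[OF edges_subset]
    by (simp add: DP_fun_cover_def chrom_fun_def)
  show ?thesis
    unfolding DP_color_fun_def
  proof (rule Min_eqI[OF finite_DP_fun_cover[OF finite_vertices]])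
    show "chrom_fun X E k \<in> DP_fun_cover X k ` {F. fold_cover X E k F}"
      using const chrom by (metis imageI mem_Collect_eq)
  next
    fix n assume "n \<in> DP_fun_cover X k ` {F. fold_cover X E k F}"
    then obtain F where "fold_cover X E k F" "n = DP_fun_cover X k F" by blast
    \<comment> \<open>Both numbers are compared with the product over the edges: the constant cover
      is full and attains it, and \<open>F\<close> has at least that many colorings.\<close>
    then show "chrom_fun X E k \<le> n"
      using count[of k F] count[OF const] full_cover_constant_cover[of E k]
      by (simp add: DP_fun_cover_def flip: chrom)
  qed
qed

end
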